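(* Let $\mathscr{H}$ be a Hilbert space, let $r$ be a positive integer, and let $P_1,\ldots,P_r\in\mathbb{B}(\mathscr{H})$ be distinct projections such that $c_b(\mathcal{R}(P_1),\ldots,\mathcal{R}(P_r))<1$. Let $\{P_i\}_{i=r+1}^\infty$ be a monotonically decreasing sequence of (not necessarily distinct) projections in $\mathbb{B}(\mathscr{H})$ such that $\bigcap_{i=1}^r\mathcal{R}(P_i)=\bigcap_{i=1}^\infty\mathcal{R}(P_i)$. Let $\sigma:\mathbb{N}\to\mathbb{N}$ be a pseudo-periodic function with $\Gamma_F=\{1,\ldots,r\}$. Set $T_1:=P_{\sigma(1)}$ and $T_n:=P_{\sigma(n)}T_{n-1}$ for $n\ge2$. Then, for every $x\in\mathscr{H}$, the sequence $\{T_nx\}$ converges strongly (in norm) to $Px$, where $P$ is the projection onto $\bigcap_{i=1}^\infty\mathcal{R}(P_i)$.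
   Context: $\mathbb{B}(\mathscr{H})$ is the algebra of bounded linear operators on $\mathscr{H}$; $\mathcal{R}(T)$ is the range of $T$. "Projection" means orthogonal projection ($P^2=P=P^*$). Monotonically decreasing means $P_{r+1}\ge P_{r+2}\ge\cdots$ in the usual operator order, equivalently the ranges are decreasing under inclusion. $\mathbb{N}=\{1,2,3,\ldots\}$. For closed subspaces $\mathscr{M}_1,\ldots,\mathscr{M}_r$ of $\mathscr{H}$ with corresponding projections $P_1,\ldots,P_r$, $$c_b(\mathscr{M}_1,\ldots,\mathscr{M}_r)=\left\|P_r\cdots P_1P_{(\bigcap_{i=1}^r\mathscr{M}_i)^\perp}\right\|,$$ where $P_{(\bigcap_{i=1}^r\mathscr{M}_i)^\perp}$ is the projection onto the orthogonal complement of $\bigcap_{i=1}^r\mathscr{M}_i$. Pseudo-periodic functions. Let $\sigma:\mathbb{N}\to\mathbb{N}$ be a function such that for each $j\in\sigma(\mathbb{N})$ the inverse image of $\{j\}$ under $\sigma$ is an infinite set ($\sigma$ is not required to be surjective). For each $j\in\sigma(\mathbb{N})$, let $\{l_n\}_{n=1}^\infty$ (depending on $j$) be the increasing sequence of all natural numbers with $\sigma(l_n)=j$, put $l_0=0$, and let $I(\sigma,j)=\sup_n(l_n-l_{n-1})$. Let $\Gamma_F$ be the set of all such $j$ with $I(\sigma,j)<\infty$ and let $\Gamma_\infty=\sigma(\mathbb{N})\setminus\Gamma_F$, so that $\Gamma_F\cup\Gamma_\infty=\sigma(\mathbb{N})$. Let $\{k_n\}$ be the complement in $\mathbb{N}$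 of the union of the sequences $\{l_n\}$ belonging to $j\in\Gamma_F$, written as an increasing sequence; thus $\sigma(k_n)\in\Gamma_\infty$. The function $\sigma$ is called pseudo-periodic if $\Gamma_F=\{1,2,\ldots,r\}$ for some positive integer $r$ and the sequence $\{k_n-k_{n-1}\}$ of differences of consecutive terms is an increasing sequence. *)

theory Defs
  imports "HOL-Analysis.Analysis"
begin

section \<open>Real and complex Hilbert spaces\<close>

text \<open>
  The scalar field is \<open>\<real>\<close> or \<open>\<complex>\<close>. The axioms below leave no other instances: a scalar \<open>z\<close> is a
  root of \<open>(X - z) (X - scnj z)\<close>, whose coefficients are real.
\<close>

class real_or_complex = real_normed_field +
  fixes scnj :: "'a \<Rightarrow> 'a"
  assumes scnj_add: "scnj (a + b) = scnj a + scnj b"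
    and scnj_mult: "scnj (a * b) = scnj a * scnj b"
    and scnj_scnj: "scnj (scnj a) = a"
    and mult_scnj: "a * scnj a = (norm a)\<^sup>2 *\<^sub>R 1"

instantiation real :: real_or_complex
begin

definition scnj_real :: "real \<Rightarrow> real" where "scnj_real a = a"

instance
  by standard (simp_all add: scnj_real_def power2_eq_square)

end

instantiation complex :: real_or_complex
begin

definition scnj_complex :: "complex \<Rightarrow> complex" where "scnj_complex = cnj"

instance
proof
  fix a b :: complex
  show "a * scnj a = (norm a)\<^sup>2 *\<^sub>R 1"
    unfolding scnj_complex_def scaleR_conv_of_real mult_1_right
    by (rule complex_norm_square[symmetric])
qed (simp_all add: scnj_complex_def)

end

text \<open>
  A Hilbert space over \<open>'k\<close>, with inner product \<open>ip\<close> linear in the first argument. Every such space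
  is also a real Hilbert space with the same norm (and inner product \<open>Re (ip x y)\<close>); that structure
  comes from the sorts of \<open>'a\<close>, and \<open>scale_of_real\<close> and \<open>ip_self\<close> tie the two together.
\<close>

locale hilbert_space = vector_space sc
  for sc :: "'k::real_or_complex \<Rightarrow> 'a::{real_inner, complete_space} \<Rightarrow> 'a" +
  fixes ip :: "'a \<Rightarrow> 'a \<Rightarrow> 'k"
  assumes scale_of_real: "sc (of_real t) x = t *\<^sub>R x"
    and ip_add_left: "ip (x + y) z = ip x z + ip y z"
    and ip_scale_left: "ip (sc c x) y = c * ip x y"
    and ip_commute: "ip y x = scnj (ip x y)"
    and ip_self: "ip x x = of_real ((norm x)\<^sup>2)"

lemma hilbert_space_real:
  "hilbert_space scaleR (inner :: 'a::{real_inner, complete_space} \<Rightarrow> 'a \<Rightarrow> real)"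
proof unfold_locales
  show "x \<bullet> x = of_real ((norm x)\<^sup>2)" for x :: 'a
    by (simp add: power2_norm_eq_inner)
  show "y \<bullet> x = scnj (x \<bullet> y)" for x y :: 'a
    by (simp add: scnj_real_def inner_commute)
qed (simp_all add: scaleR_add_left scaleR_add_right inner_add_left)

lemma hilbert_space_complex:
  "hilbert_space ((*) :: complex \<Rightarrow> complex \<Rightarrow> complex) (\<lambda>x y. x * cnj y)"
proof unfold_locales
  show "x * cnj x = of_real ((norm x)\<^sup>2)" for x :: complex
    by (rule complex_norm_square[symmetric])
  show "y * cnj x = scnj (x * cnj y)" for x y :: complex
    by (simp add: scnj_complex_def)
qed (simp_all add: distrib_left distrib_right scaleR_conv_of_real)

section \<open>Projections\<close>

definition bounded_op :: "('k \<Rightarrow> 'a::real_normed_vector \<Rightarrow> 'a) \<Rightarrow> ('a \<Rightarrow> 'a) \<Rightarrow> bool" where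
  "bounded_op sc T \<longleftrightarrow> bounded_linear T \<and> (\<forall>c x. T (sc c x) = sc c (T x))"

definition projection ::
  "('k \<Rightarrow> 'a::real_normed_vector \<Rightarrow> 'a) \<Rightarrow> ('a \<Rightarrow> 'a \<Rightarrow> 'k) \<Rightarrow> ('a \<Rightarrow> 'a) \<Rightarrow> bool" where
  "projection sc ip P \<longleftrightarrow>
     bounded_op sc P \<and> P \<circ> P = P \<and> (\<forall>x y. ip (P x) y = ip x (P y))"

definition proj_onto ::
  "('k \<Rightarrow> 'a::real_normed_vector \<Rightarrow> 'a) \<Rightarrow> ('a \<Rightarrow> 'a \<Rightarrow> 'k) \<Rightarrow> 'a set \<Rightarrow> 'a \<Rightarrow> 'a" where
  "proj_onto sc ip M = (THE P. projection sc ip P \<and> range P = M)"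

definition orth_compl :: "('a \<Rightarrow> 'a \<Rightarrow> 'k::zero) \<Rightarrow> 'a set \<Rightarrow> 'a set" where
  "orth_compl ip M = {x. \<forall>y\<in>M. ip x y = 0}"

text \<open>The order \<open>S \<le> T\<close> of self-adjoint operators: \<open>\<langle>(T - S) x, x\<rangle> \<ge> 0\<close> for all \<open>x\<close>.\<close>

definition op_le ::
  "('a \<Rightarrow> 'a \<Rightarrow> 'k::real_or_complex) \<Rightarrow> ('a::minus \<Rightarrow> 'a) \<Rightarrow> ('a \<Rightarrow> 'a) \<Rightarrow> bool" where
  "op_le ip S T \<longleftrightarrow> (\<forall>x. \<exists>t\<ge>0. ip (T x - S x) x = of_real t)"

text \<open>\<open>left_prod P r = P r \<circ> \<dots> \<circ> P 1\<close>\<close>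

primrec left_prod :: "(nat \<Rightarrow> 'a \<Rightarrow> 'a) \<Rightarrow> nat \<Rightarrow> 'a \<Rightarrow> 'a" where
  "left_prod P 0 = id"
| "left_prod P (Suc n) = P (Suc n) \<circ> left_prod P n"

definition c_b ::
  "('k \<Rightarrow> 'a::real_normed_vector \<Rightarrow> 'a) \<Rightarrow> ('a \<Rightarrow> 'a \<Rightarrow> 'k::zero) \<Rightarrow> nat \<Rightarrow> (nat \<Rightarrow> 'a set) \<Rightarrow> real" where
  "c_b sc ip r M =
     onorm (left_prod (\<lambda>i. proj_onto sc ip (M i)) r
            \<circ> proj_onto sc ip (orth_compl ip (\<Inter>i\<in>{1..r}. M i)))"

lemma (in hilbert_space) ip_right_eqI:
  assumes "\<And>z. ip x z = ip y z"
  shows "x = y"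
proof -
  have "ip (x - y) (x - y) + ip y (x - y) = ip y (x - y)"
    using ip_add_left[of "x - y" y "x - y"] assms[of "x - y"] by simp
  then have "ip (x - y) (x - y) = 0"
    by simp
  then show ?thesis
    by (simp add: ip_self)
qed

lemma (in hilbert_space) projection_unique:
  assumes P: "projection sc ip P" and Q: "projection sc ip Q" and eq: "range P = range Q"
  shows "P = Q"
proof
  fix x
  have fixes_range: "R y = y" if "projection sc ip R" "y \<in> range R" for R y
    using that by (auto simp: projection_def fun_eq_iff)
  show "P x = Q x"
  proof (rule ip_right_eqI)
    fix z
    have "Q (P x) = P x"
      using fixes_range[OF Q] eq by blast
    moreover have "ip (Q (P x)) z = ip (P x) (Q z)"
      using Q by (simp add: projection_def)
    ultimately have "ip (P x) z = ip (P x) (Q z)"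
      by simp
    also have "\<dots> = ip x (P (Q z))"
      using P by (simp add: projection_def)
    also have "P (Q z) = Q z"
      using fixes_range[OF P] eq by blast
    also have "ip x (Q z) = ip (Q x) z"
      using Q by (simp add: projection_def)
    finally show "ip (P x) z = ip (Q x) z" .
  qed
qed

lemma (in hilbert_space) proj_onto_range:
  assumes "projection sc ip P"
  shows "proj_onto sc ip (range P) = P"
  unfolding proj_onto_def
proof (rule the_equality)
  show "Q = P" if "projection sc ip Q \<and> range Q = range P" for Q
    using that assms projection_unique by metis
qed (simp add: assms)

section \<open>Pseudo-periodic functions\<close>

text \<open>
  The natural numbers of the source start at \<open>1\<close>, so sequences and \<open>\<sigma>\<close> are only looked at on \<open>{1..}\<close>;
  their values at \<open>0\<close> are irrelevant.
\<close>

definition fiber :: "(nat \<Rightarrow> nat) \<Rightarrow> nat \<Rightarrow> nat set" where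
  "fiber \<sigma> j = {n. n \<ge> 1 \<and> \<sigma> n = j}"

text \<open>\<open>l\<^sub>0 = 0\<close>; note that \<^const>\<open>enumerate\<close> counts from \<open>0\<close>.\<close>

definition l_seq :: "(nat \<Rightarrow> nat) \<Rightarrow> nat \<Rightarrow> nat \<Rightarrow> nat" where
  "l_seq \<sigma> j n = (case n of 0 \<Rightarrow> 0 | Suc m \<Rightarrow> enumerate (fiber \<sigma> j) m)"

definition I_gap :: "(nat \<Rightarrow> nat) \<Rightarrow> nat \<Rightarrow> enat" where
  "I_gap \<sigma> j = (SUP n\<in>{1..}. enat (l_seq \<sigma> j n - l_seq \<sigma> j (n - 1)))"

definition Gamma_F :: "(nat \<Rightarrow> nat) \<Rightarrow> nat set" where
  "Gamma_F \<sigma> = {j \<in> \<sigma> ` {1..}. I_gap \<sigma> j < \<infinity>}"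

definition K_set :: "(nat \<Rightarrow> nat) \<Rightarrow> nat set" where
  "K_set \<sigma> = {1..} - (\<Union>j\<in>Gamma_F \<sigma>. fiber \<sigma> j)"

text \<open>
  If \<open>K_set \<sigma>\<close> is nonempty it is infinite, being a union of fibers. If it is empty there is no
  sequence \<open>k\<close> and the condition on its differences is vacuous. ``Increasing'' is read as
  nondecreasing, which includes the strict reading.
\<close>

definition pseudo_periodic :: "(nat \<Rightarrow> nat) \<Rightarrow> bool" where
  "pseudo_periodic \<sigma> \<longleftrightarrow>
     \<sigma> ` {1..} \<subseteq> {1..} \<and>
     (\<forall>j\<in>\<sigma> ` {1..}. infinite (fiber \<sigma> j)) \<and>
     (\<exists>r\<ge>1. Gamma_F \<sigma> = {1..r}) \<and>
     (K_set \<sigma> \<noteq> {} \<longrightarrow>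
       incseq (\<lambda>n. enumerate (K_set \<sigma>) (Suc n) - enumerate (K_set \<sigma>) n))"

end

theory Submission
  imports Defs
begin

text \<open>
  Let \<open>M\<close> be the intersection of all the ranges. Every \<open>P\<^sub>i\<close> is the identity on \<open>M\<close> and maps the
  orthogonal complement of \<open>M\<close> into itself, so it suffices to show \<open>T\<^sub>n x \<rightarrow> 0\<close> for \<open>x\<close> orthogonal
  to \<open>M\<close>.

  An orthogonal projection \<open>E\<close> satisfies \<open>\<parallel>y - E y\<parallel>\<^sup>2 = \<parallel>y\<parallel>\<^sup>2 - \<parallel>E y\<parallel>\<^sup>2\<close>: a vector moves only at the
  expense of its norm. The indices \<open>1, \<dots>, r\<close> recur in \<open>\<sigma>\<close> with bounded gaps, so for some \<open>L\<close>
  each of \<open>P\<^sub>1, \<dots>, P\<^sub>r\<close> is applied within every \<open>L\<close> consecutive steps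
  (\<open>pseudo_periodic_visits\<close>). Suppose that the orbit of \<open>y\<close> loses little norm during \<open>L\<close> steps.
  Then all its points in that window stay near \<open>y\<close>, whichever projections were applied in between.
  One of these points lies in the range of \<open>P\<^sub>i\<close>, so \<open>P\<^sub>i y\<close> is near \<open>y\<close> for every \<open>i \<le> r\<close>, and
  hence so is \<open>P\<^sub>r \<cdots> P\<^sub>1 y\<close>. But \<open>\<parallel>P\<^sub>r \<cdots> P\<^sub>1 y\<parallel> \<le> c \<parallel>y\<parallel>\<close> with \<open>c = c\<^sub>b < 1\<close>. So the loss in a window
  is at least a fixed proportion of \<open>\<parallel>y\<parallel>\<^sup>2\<close> (\<open>window_contraction\<close>), and the norms along the orbit
  decrease to \<open>0\<close> (\<open>orbit_tendsto_0\<close>).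

  Both the limit and \<open>c\<^sub>b\<close> are given by definite descriptions, so the projections onto \<open>M\<close> and onto its
  orthogonal complement have to be shown to exist (\<open>projection_onto_closed_subspace\<close>,
  \<open>proj_onto_orth_compl\<close>). The nearest point is found in the underlying real Hilbert space;
  orthogonality to a \<open>'k\<close>-linear subspace means the same for the real inner product and for \<open>ip\<close>.
\<close>

section \<open>The inner product and the underlying real inner product\<close>

lemma scnj_of_real: "scnj (of_real t :: 'k::real_or_complex) = of_real t"
proof (cases "t = 0")
  case True
  have "scnj (0::'k) + scnj 0 = scnj 0"
    using scnj_add[of "0::'k" 0] by simp
  then show ?thesis using True by simp
next
  case False
  have "of_real t * scnj (of_real t :: 'k) = of_real t * of_real t"
    using mult_scnj[of "of_real t :: 'k"] by (simp add: of_real_def power2_eq_square)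
  then show ?thesis using False by simp
qed

context hilbert_space
begin

lemma ip_add_right: "ip x (y + z) = ip x y + ip x z"
  using ip_add_left[of y z x] by (metis ip_commute scnj_add)

lemma ip_scale_right: "ip x (sc c y) = scnj c * ip x y"
  using ip_scale_left[of c y x] by (metis ip_commute scnj_mult)

lemma ip_zero_left [simp]: "ip 0 y = 0"
  using ip_add_left[of 0 0 y] by simp

lemma ip_diff_left: "ip (x - y) z = ip x z - ip y z"
  using ip_add_left[of "x - y" y z] by (simp add: algebra_simps)

lemma ip_diff_right: "ip x (y - z) = ip x y - ip x z"
  using ip_add_right[of x "y - z" z] by (simp add: algebra_simps)

lemma ip_eq_0_sym: "ip x y = 0 \<longleftrightarrow> ip y x = 0"
  using scnj_of_real[of 0, where ?'k = 'k] by (metis ip_commute of_real_0)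

text \<open>Polarization: the real inner product is the real part of \<open>ip\<close>.\<close>

lemma ip_plus_scnj: "ip x y + scnj (ip x y) = of_real (2 * (x \<bullet> y))"
proof -
  have "ip (x + y) (x + y) = ip x x + (ip x y + ip y x) + ip y y"
    by (simp add: ip_add_left ip_add_right)
  moreover have "(norm (x + y))\<^sup>2 = (norm x)\<^sup>2 + 2 * (x \<bullet> y) + (norm y)\<^sup>2"
    by (simp add: power2_norm_eq_inner inner_simps inner_commute)
  ultimately have "of_real ((norm x)\<^sup>2) + of_real (2 * (x \<bullet> y)) + of_real ((norm y)\<^sup>2)
      = of_real ((norm x)\<^sup>2) + (ip x y + ip y x) + (of_real ((norm y)\<^sup>2) :: 'k)"
    by (simp only: ip_self of_real_add)
  then have "of_real (2 * (x \<bullet> y)) = ip x y + ip y x"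
    by (simp only: add_left_cancel add_right_cancel)
  then show ?thesis
    by (simp add: ip_commute[of y x])
qed

lemma inner_eq_if_ip_eq: "ip x y = ip x' y' \<Longrightarrow> x \<bullet> y = x' \<bullet> y'"
  using ip_plus_scnj[of x y] ip_plus_scnj[of x' y'] by simp

text \<open>
  If \<open>x\<close> is orthogonal to all of a \<open>'k\<close>-subspace in the real sense, then it is so for \<open>ip\<close>: rotating
  \<open>y\<close> by the scalar \<open>ip x y\<close> makes the inner product with \<open>x\<close> real, and leaves \<open>y\<close> in the subspace.
\<close>

lemma ip_eq_0_if_inner_eq_0:
  assumes "x \<bullet> sc (ip x y) y = 0"
  shows "ip x y = 0"
proof -
  have "ip x (sc (ip x y) y) = of_real ((norm (ip x y))\<^sup>2)"
    using mult_scnj[of "ip x y"] by (simp add: ip_scale_right of_real_def mult.commute)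
  then have "of_real (2 * (norm (ip x y))\<^sup>2) = (of_real 0 :: 'k)"
    using ip_plus_scnj[of x "sc (ip x y) y"] assms by (simp only: scnj_of_real) simp
  then have "2 * (norm (ip x y))\<^sup>2 = 0"
    by (simp only: of_real_eq_iff)
  then show ?thesis by simp
qed

end

section \<open>Existence of orthogonal projections\<close>

text \<open>
  The foot is the nearest point of \<open>M\<close> to \<open>x\<close>. By the parallelogram law, a sequence in \<open>M\<close> whose
  distances to \<open>x\<close> approach the infimum is Cauchy, because the midpoints also lie in \<open>M\<close>; at the
  limit, minimality along lines in \<open>M\<close> gives orthogonality.
\<close>

lemma orthogonal_foot_exists:
  fixes x :: "'a::{real_inner, complete_space}"
  assumes "closed M" and "subspace M"
  shows "\<exists>p\<in>M. \<forall>y\<in>M. (x - p) \<bullet> y = 0"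
proof -
  define d where "d = (INF y\<in>M. (norm (x - y))\<^sup>2)"
  have "M \<noteq> {}"
    using assms(2) subspace_0 by blast
  have bdd: "bdd_below ((\<lambda>y. (norm (x - y))\<^sup>2) ` M)"
    by (rule bdd_belowI[of _ 0]) auto
  have d_le: "d \<le> (norm (x - y))\<^sup>2" if "y \<in> M" for y
    unfolding d_def by (rule cINF_lower[OF bdd that])
  have "\<exists>y\<in>M. (norm (x - y))\<^sup>2 < d + 1 / real (Suc n)" for n
    using cINF_less_iff[OF \<open>M \<noteq> {}\<close> bdd, of "d + 1 / real (Suc n)"]
    unfolding d_def[symmetric] by simp
  then obtain s where sM: "\<And>n. s n \<in> M" and s: "\<And>n. (norm (x - s n))\<^sup>2 < d + 1 / real (Suc n)"
    by metis
  have close: "(dist (s m) (s n))\<^sup>2 \<le> 4 / real (Suc N)" if "N \<le> m" "N \<le> n" for m n N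
  proof -
    have "(1/2) *\<^sub>R (s m + s n) \<in> M"
      using assms(2) sM by (simp add: subspace_add subspace_mul)
    then have "4 * d \<le> 4 * (norm (x - (1/2) *\<^sub>R (s m + s n)))\<^sup>2"
      using d_le by simp
    also have "\<dots> = 2 * (norm (x - s m))\<^sup>2 + 2 * (norm (x - s n))\<^sup>2 - (dist (s m) (s n))\<^sup>2"
      by (simp add: dist_norm power2_norm_eq_inner inner_simps inner_commute algebra_simps)
    finally have "(dist (s m) (s n))\<^sup>2 \<le> 2 / real (Suc m) + 2 / real (Suc n)"
      using s[of m] s[of n] by simp
    also have "\<dots> \<le> 2 / real (Suc N) + 2 / real (Suc N)"
      using that by (intro add_mono divide_left_mono) auto
    finally show ?thesis by simp
  qed
  have "Cauchy s"
  proof (rule metric_CauchyI)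
    fix e :: real assume "0 < e"
    then obtain N where "4 / e\<^sup>2 < real N"
      using reals_Archimedean2 by blast
    then have "4 < real (Suc N) * e\<^sup>2"
      using \<open>0 < e\<close> by (simp add: field_simps add_strict_increasing2)
    then have N: "4 / real (Suc N) < e\<^sup>2"
      by (simp add: field_simps)
    show "\<exists>N. \<forall>m\<ge>N. \<forall>n\<ge>N. dist (s m) (s n) < e"
    proof (intro exI allI impI)
      fix m n assume "N \<le> m" "N \<le> n"
      then have "(dist (s m) (s n))\<^sup>2 < e\<^sup>2"
        using close N by (meson le_less_trans)
      then show "dist (s m) (s n) < e"
        using \<open>0 < e\<close> by (simp add: power_less_imp_less_base)
    qed
  qed
  then obtain p where p: "s \<longlonglongrightarrow> p"
    using Cauchy_convergent convergent_def by blast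
  have "p \<in> M"
    using closed_sequentially[OF assms(1) _ p] sM by blast
  have "(norm (x - p))\<^sup>2 \<le> d + 0"
  proof (rule LIMSEQ_le)
    show "(\<lambda>n. (norm (x - s n))\<^sup>2) \<longlonglongrightarrow> (norm (x - p))\<^sup>2"
      by (intro tendsto_intros p)
    show "(\<lambda>n. d + 1 / real (Suc n)) \<longlonglongrightarrow> d + 0"
      by (intro tendsto_intros LIMSEQ_Suc[OF lim_1_over_n])
  qed (use s in \<open>meson less_imp_le\<close>)
  then have min: "(norm (x - p))\<^sup>2 \<le> (norm (x - y))\<^sup>2" if "y \<in> M" for y
    using d_le[OF that] by linarith
  have "(x - p) \<bullet> y = 0" if "y \<in> M" for y
  proof (cases "y = 0")
    case False
    have expand: "(norm (a - t *\<^sub>R y))\<^sup>2 = (norm a)\<^sup>2 - 2 * t * (a \<bullet> y) + t * (t * (norm y)\<^sup>2)"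
      for a t
      by (simp add: power2_norm_eq_inner inner_simps inner_commute algebra_simps)
    \<comment> \<open>\<open>p + t y\<close> is the nearest point to \<open>x\<close> on the line through \<open>p\<close> in direction \<open>y\<close>.\<close>
    define t where "t = (x - p) \<bullet> y / (norm y)\<^sup>2"
    have "p + t *\<^sub>R y \<in> M"
      using assms(2) \<open>p \<in> M\<close> that by (simp add: subspace_add subspace_mul)
    then have "(norm (x - p))\<^sup>2 \<le> (norm ((x - p) - t *\<^sub>R y))\<^sup>2"
      using min by (metis diff_diff_eq)
    also have "\<dots> = (norm (x - p))\<^sup>2 - 2 * t * ((x - p) \<bullet> y) + t * (t * (norm y)\<^sup>2)"
      by (rule expand)
    also have "t * (norm y)\<^sup>2 = (x - p) \<bullet> y"
      using False by (simp add: t_def)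
    finally have "t * ((x - p) \<bullet> y) \<le> 0"
      by simp
    moreover have "t * ((x - p) \<bullet> y) = ((x - p) \<bullet> y)\<^sup>2 / (norm y)\<^sup>2"
      by (simp add: t_def power2_eq_square)
    ultimately show ?thesis
      using False by (simp add: divide_le_0_iff)
  qed simp
  with \<open>p \<in> M\<close> show ?thesis by blast
qed

context hilbert_space
begin

lemma real_subspace: "subspace M \<Longrightarrow> real_vector.subspace M"
  unfolding real_vector.subspace_def subspace_def
  by (metis scale_of_real)

lemma projection_bounded_linear: "projection sc ip E \<Longrightarrow> bounded_linear E"
  by (simp add: projection_def bounded_op_def)

lemma projection_idem: "projection sc ip E \<Longrightarrow> E (E x) = E x"
  by (simp add: projection_def fun_eq_iff)

lemma projection_in_range_iff: "projection sc ip E \<Longrightarrow> x \<in> range E \<longleftrightarrow> E x = x"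
  using projection_idem by (metis rangeE rangeI)

lemma projection_ip: "projection sc ip E \<Longrightarrow> ip (E x) y = ip x (E y)"
  by (simp add: projection_def)

lemma projection_pythagoras:
  assumes "projection sc ip E"
  shows "(norm x)\<^sup>2 = (norm (E x))\<^sup>2 + (norm (x - E x))\<^sup>2"
proof -
  have "ip x (E x) = ip (E x) (E x)"
    using projection_ip[OF assms] projection_idem[OF assms] by metis
  then have "x \<bullet> E x = E x \<bullet> E x"
    by (rule inner_eq_if_ip_eq)
  then show ?thesis
    by (simp add: power2_norm_eq_inner inner_simps inner_commute)
qed

lemma projection_norm_le: "projection sc ip E \<Longrightarrow> norm (E x) \<le> norm x"
  by (rule power2_le_imp_le) (simp_all add: projection_pythagoras[of E x])

lemma closed_range_projection:
  assumes "projection sc ip E"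
  shows "closed (range E)"
proof -
  have "continuous_on UNIV E"
    using projection_bounded_linear[OF assms] by (rule bounded_linear.continuous_on) simp
  then have "closed {x. E x = x}"
    by (intro closed_Collect_eq continuous_on_id)
  moreover have "range E = {x. E x = x}"
    using projection_in_range_iff[OF assms] by blast
  ultimately show ?thesis by simp
qed

lemma subspace_range_projection:
  assumes "projection sc ip E"
  shows "subspace (range E)"
proof -
  interpret bounded_linear E
    by (rule projection_bounded_linear[OF assms])
  have "E (sc c x) = sc c (E x)" for c x
    using assms by (simp add: projection_def bounded_op_def)
  then show ?thesis
    unfolding subspace_def projection_in_range_iff[OF assms] by (simp add: zero add projection_idem[OF assms])
qed

text \<open>
  A choice of a foot of the perpendicular for each point is already a projection: feet are unique,
  and sums and scalar multiples of feet are feet.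
\<close>

lemma projectionI:
  assumes sub: "subspace M" and EM: "\<And>x. E x \<in> M" and orth: "\<And>x y. y \<in> M \<Longrightarrow> ip (x - E x) y = 0"
  shows "projection sc ip E" and "range E = M"
proof -
  have orth': "ip y (x - E x) = 0" if "y \<in> M" for x y
    using orth[OF that] ip_eq_0_sym by metis
  have unique: "E x = m" if "m \<in> M" and "\<And>y. y \<in> M \<Longrightarrow> ip (x - m) y = 0" for x m
  proof -
    have "E x - m \<in> M"
      using sub EM that(1) by (rule subspace_diff)
    then have "ip ((x - m) - (x - E x)) (E x - m) = 0"
      using that(2) orth by (metis ip_diff_left diff_zero)
    then have "ip (E x - m) (E x - m) = 0"
      by simp
    then show ?thesis
      by (simp add: ip_self)
  qed
  have add: "E (x + y) = E x + E y" for x y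
  proof (rule unique)
    have "x + y - (E x + E y) = (x - E x) + (y - E y)"
      by simp
    then show "ip (x + y - (E x + E y)) z = 0" if "z \<in> M" for z
      using that by (simp only: ip_add_left orth add_0)
  qed (use sub EM in \<open>simp add: subspace_add\<close>)
  have scale: "E (sc c x) = sc c (E x)" for c x
  proof (rule unique)
    show "ip (sc c x - sc c (E x)) z = 0" if "z \<in> M" for z
      using that by (simp add: scale_right_diff_distrib[symmetric] ip_scale_left orth)
  qed (use sub EM in \<open>simp add: subspace_scale\<close>)
  have fix_M: "E m = m" if "m \<in> M" for m
    by (rule unique) (use that in simp_all)
  have self_adjoint: "ip (E x) y = ip x (E y)" for x y
  proof -
    have "ip (E x) y = ip (E x) (E y)"
      using orth'[OF EM, of x y] by (simp add: ip_diff_right)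
    also have "\<dots> = ip x (E y)"
      using orth[OF EM, of x y] by (simp add: ip_diff_left)
    finally show ?thesis .
  qed
  have "norm (E x) \<le> norm x * 1" for x
  proof -
    have "ip x (E x) = ip (E x) (E x)"
      using self_adjoint fix_M EM by metis
    then have "(norm (E x))\<^sup>2 = x \<bullet> E x"
      using inner_eq_if_ip_eq by (metis power2_norm_eq_inner)
    also have "\<dots> \<le> norm x * norm (E x)"
      by (rule norm_cauchy_schwarz)
    finally show ?thesis
      by (cases "E x = 0") (simp_all add: power2_eq_square)
  qed
  then have "bounded_linear E"
    by (intro bounded_linear_intro[where K = 1] add) (metis scale scale_of_real)
  then show "projection sc ip E"
    using scale fix_M EM self_adjoint by (auto simp: projection_def bounded_op_def)
  show "range E = M"
    using fix_M EM by (metis rangeI subsetI subset_antisym image_subsetI)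
qed

lemma projection_onto_closed_subspace:
  assumes "closed M" and "subspace M"
  shows "projection sc ip (proj_onto sc ip M)" and "range (proj_onto sc ip M) = M"
proof -
  have "\<exists>p\<in>M. \<forall>y\<in>M. ip (x - p) y = 0" for x
  proof -
    obtain p where "p \<in> M" and p: "\<And>y. y \<in> M \<Longrightarrow> (x - p) \<bullet> y = 0"
      using orthogonal_foot_exists[OF assms(1) real_subspace[OF assms(2)]] by blast
    have "ip (x - p) y = 0" if "y \<in> M" for y
      by (rule ip_eq_0_if_inner_eq_0) (simp add: p subspace_scale[OF assms(2) that])
    with \<open>p \<in> M\<close> show ?thesis by blast
  qed
  then obtain E where "\<And>x. E x \<in> M" and "\<And>x y. y \<in> M \<Longrightarrow> ip (x - E x) y = 0"
    by metis
  note E = projectionI[OF assms(2) this]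
  then have "proj_onto sc ip M = E"
    using proj_onto_range by blast
  then show "projection sc ip (proj_onto sc ip M)" and "range (proj_onto sc ip M) = M"
    using E by simp_all
qed

lemma proj_onto_orth_compl:
  assumes E: "projection sc ip E"
  shows "proj_onto sc ip (orth_compl ip (range E)) = (\<lambda>x. x - E x)"
proof -
  have "subspace (orth_compl ip (range E))"
    by (auto simp: subspace_def orth_compl_def ip_add_left ip_scale_left)
  moreover have "x - E x \<in> orth_compl ip (range E)" for x
    by (auto simp: orth_compl_def ip_diff_left projection_ip[OF E] projection_idem[OF E])
  moreover have "ip (x - (x - E x)) y = 0" if "y \<in> orth_compl ip (range E)" for x y
    using that ip_eq_0_sym by (auto simp: orth_compl_def)
  ultimately have "projection sc ip (\<lambda>x. x - E x)"
      and "range (\<lambda>x. x - E x) = orth_compl ip (range E)"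
    using projectionI[where E = "\<lambda>x. x - E x" and M = "orth_compl ip (range E)"] by blast+
  then show ?thesis
    using proj_onto_range by metis
qed

end

section \<open>Orbits under a sequence of projections\<close>

context hilbert_space
begin

lemma orbit_norm_antimono:
  assumes "\<And>n. projection sc ip (E n)" and "\<And>n. u (Suc n) = E n (u n)" and "m \<le> n"
  shows "norm (u n) \<le> norm (u m)"
  using \<open>m \<le> n\<close>
  by (induction rule: dec_induct)
    (auto intro: order_trans projection_norm_le assms(1) simp: assms(2))

text \<open>
  By Pythagoras, the squared length of each step is the loss of squared norm in that step, hence at
  most the loss over the whole window of length \<open>L\<close>.
\<close>

lemma orbit_displacement:
  assumes E: "\<And>n. projection sc ip (E n)" and u: "\<And>n. u (Suc n) = E n (u n)" and "k \<le> L"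
  shows "norm (u (n + k) - u n) \<le> k * sqrt ((norm (u n))\<^sup>2 - (norm (u (n + L)))\<^sup>2)"
  using \<open>k \<le> L\<close>
proof (induction k)
  case (Suc k)
  let ?\<delta> = "sqrt ((norm (u n))\<^sup>2 - (norm (u (n + L)))\<^sup>2)"
  have "(norm (u (n + Suc k) - u (n + k)))\<^sup>2 = (norm (u (n + k)))\<^sup>2 - (norm (u (n + Suc k)))\<^sup>2"
    using projection_pythagoras[OF E[of "n + k"], of "u (n + k)"] u[of "n + k"]
    by (simp add: norm_minus_commute)
  also have "\<dots> \<le> (norm (u n))\<^sup>2 - (norm (u (n + L)))\<^sup>2"
    using Suc.prems by (intro diff_mono power_mono orbit_norm_antimono[of E, OF E u]) auto
  finally have "norm (u (n + Suc k) - u (n + k)) \<le> ?\<delta>"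
    by (rule real_le_rsqrt)
  moreover have "norm (u (n + k) - u n) \<le> k * ?\<delta>"
    using Suc by simp
  moreover have "norm (u (n + Suc k) - u n) \<le> norm (u (n + Suc k) - u (n + k)) + norm (u (n + k) - u n)"
    using norm_triangle_ineq[of "u (n + Suc k) - u (n + k)" "u (n + k) - u n"] by simp
  ultimately show ?case
    by (simp add: algebra_simps)
qed simp

text \<open>Projections do not increase norms, so the displacements by the single factors add up.\<close>

lemma left_prod_displacement:
  assumes "\<And>i. i \<in> {1..r} \<Longrightarrow> projection sc ip (P i)" and "\<And>i. i \<in> {1..r} \<Longrightarrow> norm (P i y - y) \<le> \<epsilon>"
  shows "norm (left_prod P r y - y) \<le> r * \<epsilon>"
  using assms
proof (induction r)
  case (Suc r)
  let ?z = "left_prod P r y"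
  have P: "projection sc ip (P (Suc r))"
    by (simp add: Suc.prems)
  interpret bounded_linear "P (Suc r)"
    by (rule projection_bounded_linear[OF P])
  have "norm (left_prod P (Suc r) y - y) = norm (P (Suc r) (?z - y) + (P (Suc r) y - y))"
    by (simp add: diff)
  also have "\<dots> \<le> norm (?z - y) + norm (P (Suc r) y - y)"
    using projection_norm_le[OF P] by (rule norm_triangle_le[OF add_right_mono])
  also have "\<dots> \<le> r * \<epsilon> + \<epsilon>"
    using Suc by (intro add_mono) auto
  finally show ?case
    by (simp add: algebra_simps)
qed simp

text \<open>
  The quantitative core: if each \<open>P i\<close> with \<open>i \<le> r\<close> occurs in the window and \<open>c < 1\<close>, the loss of
  squared norm over the window is bounded below by a positive multiple of \<open>\<parallel>u n\<parallel>\<^sup>2\<close> that does not depend on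
  \<open>n\<close> or on the other projections in the window. Writing \<open>\<delta>\<^sup>2\<close> for the loss, the orbit stays within
  \<open>L \<delta>\<close> of \<open>u n\<close> and passes through the range of each \<open>P i\<close>. So each \<open>P i\<close> moves \<open>u n\<close> by at most
  \<open>2 L \<delta>\<close> and their product moves it by at most \<open>2 r L \<delta>\<close>, whereas it must move it by at least
  \<open>(1 - c) \<parallel>u n\<parallel>\<close>.
\<close>

lemma window_contraction:
  assumes E: "\<And>n. projection sc ip (E n)" and u: "\<And>n. u (Suc n) = E n (u n)"
    and P: "\<And>i. i \<in> {1..r} \<Longrightarrow> projection sc ip (P i)"
    and visits: "\<And>i. i \<in> {1..r} \<Longrightarrow> \<exists>k<L. E (n + k) = P i"
    and c: "norm (left_prod P r (u n)) \<le> c * norm (u n)" "c \<le> 1"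
  shows "((1 - c) * norm (u n))\<^sup>2 \<le> (2 * real r * real L)\<^sup>2 * ((norm (u n))\<^sup>2 - (norm (u (n + L)))\<^sup>2)"
proof -
  let ?y = "u n" and ?\<delta> = "sqrt ((norm (u n))\<^sup>2 - (norm (u (n + L)))\<^sup>2)"
  have loss: "0 \<le> (norm ?y)\<^sup>2 - (norm (u (n + L)))\<^sup>2"
    using orbit_norm_antimono[of E, OF E u, of n "n + L"] by (simp add: power_mono)
  have "norm (P i ?y - ?y) \<le> 2 * L * ?\<delta>" if i: "i \<in> {1..r}" for i
  proof -
    obtain k where "k < L" and k: "E (n + k) = P i"
      using visits[OF i] by blast
    interpret bounded_linear "P i"
      by (rule projection_bounded_linear[OF P[OF i]])
    let ?z = "u (n + Suc k)"
    have "P i ?z = ?z"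
      using u[of "n + k"] k projection_idem[OF P[OF i]] by simp
    then have "norm (P i ?y - ?y) = norm (P i (?y - ?z) + (?z - ?y))"
      by (simp add: diff)
    also have "\<dots> \<le> norm (?y - ?z) + norm (?z - ?y)"
      using projection_norm_le[OF P[OF i]] by (rule norm_triangle_le[OF add_right_mono])
    also have "\<dots> = 2 * norm (?z - ?y)"
      by (simp add: norm_minus_commute)
    also have "norm (?z - ?y) \<le> Suc k * ?\<delta>"
      by (rule orbit_displacement[of E, OF E u]) (use \<open>k < L\<close> in simp)
    also have "\<dots> \<le> L * ?\<delta>"
      using \<open>k < L\<close> loss by (intro mult_right_mono) auto
    finally show ?thesis
      by simp
  qed
  then have "norm (left_prod P r ?y - ?y) \<le> r * (2 * L * ?\<delta>)"
    by (intro left_prod_displacement P)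
  then have "(1 - c) * norm ?y \<le> 2 * r * L * ?\<delta>"
    using c norm_triangle_ineq2[of ?y "left_prod P r ?y"]
    by (simp add: norm_minus_commute algebra_simps)
  then have "((1 - c) * norm ?y)\<^sup>2 \<le> (2 * r * L * ?\<delta>)\<^sup>2"
    using c by (intro power_mono) auto
  then show ?thesis
    using loss by (simp add: power_mult_distrib)
qed

text \<open>
  The norms decrease to a limit \<open>l\<close>, so the loss over a window tends to \<open>0\<close>; the lower bound for the
  loss then forces \<open>l = 0\<close>.
\<close>

lemma orbit_tendsto_0:
  assumes E: "\<And>n. projection sc ip (E n)" and u: "\<And>n. u (Suc n) = E n (u n)"
    and P: "\<And>i. i \<in> {1..r} \<Longrightarrow> projection sc ip (P i)"
    and visits: "\<And>n i. i \<in> {1..r} \<Longrightarrow> \<exists>k<L. E (n + k) = P i"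
    and c: "\<And>n. norm (left_prod P r (u n)) \<le> c * norm (u n)" "c < 1"
  shows "u \<longlonglongrightarrow> 0"
proof -
  have "decseq (\<lambda>n. norm (u n))"
    using orbit_norm_antimono[of E, OF E u] by (simp add: decseq_def)
  then obtain l where l: "(\<lambda>n. norm (u n)) \<longlonglongrightarrow> l"
    using decseq_convergent[of "\<lambda>n. norm (u n)" 0] by auto
  have "((1 - c) * l)\<^sup>2 \<le> (2 * real r * real L)\<^sup>2 * (l\<^sup>2 - l\<^sup>2)"
  proof (rule LIMSEQ_le)
    show "(\<lambda>n. ((1 - c) * norm (u n))\<^sup>2) \<longlonglongrightarrow> ((1 - c) * l)\<^sup>2"
      by (intro tendsto_intros l)
    show "(\<lambda>n. (2 * real r * real L)\<^sup>2 * ((norm (u n))\<^sup>2 - (norm (u (n + L)))\<^sup>2))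
        \<longlonglongrightarrow> (2 * real r * real L)\<^sup>2 * (l\<^sup>2 - l\<^sup>2)"
      by (intro tendsto_intros l LIMSEQ_ignore_initial_segment[OF l])
    show "\<exists>N. \<forall>n\<ge>N. ((1 - c) * norm (u n))\<^sup>2
        \<le> (2 * real r * real L)\<^sup>2 * ((norm (u n))\<^sup>2 - (norm (u (n + L)))\<^sup>2)"
      using window_contraction[where E = E and P = P, OF E u P visits c(1)] c(2) by simp
  qed
  then have "l = 0"
    using c(2) by simp
  then show ?thesis
    using l tendsto_norm_zero_iff by blast
qed

end

section \<open>Recurrence of pseudo-periodic functions\<close>

lemma bounded_gap_visits:
  assumes inf: "infinite (fiber \<sigma> j)" and gap: "I_gap \<sigma> j < \<infinity>"
  shows "\<exists>B. \<forall>n. \<exists>k\<in>{n<..n + B}. \<sigma> k = j"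
proof -
  obtain B where B: "I_gap \<sigma> j = enat B"
    using gap by (cases "I_gap \<sigma> j") auto
  have step: "l_seq \<sigma> j m \<le> l_seq \<sigma> j (m - 1) + B" if "m \<ge> 1" for m
  proof -
    have "enat (l_seq \<sigma> j m - l_seq \<sigma> j (m - 1)) \<le> I_gap \<sigma> j"
      unfolding I_gap_def by (rule SUP_upper) (use that in simp)
    then show ?thesis
      using B by simp
  qed
  have "\<exists>k\<in>{n<..n + B}. \<sigma> k = j" for n
  proof -
    have "n < l_seq \<sigma> j (Suc (Suc n))"
      using le_enumerate[OF inf, of "Suc n"] by (simp add: l_seq_def)
    \<comment> \<open>The first visit after time \<open>n\<close>; the previous one (or \<open>l\<^sub>0 = 0\<close>) is at most \<open>n\<close>.\<close>
    define m where "m = (LEAST m. n < l_seq \<sigma> j m)"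
    have m: "n < l_seq \<sigma> j m"
      unfolding m_def by (rule LeastI) fact
    then obtain m' where m': "m = Suc m'"
      by (cases m) (auto simp: l_seq_def)
    have "l_seq \<sigma> j (m - 1) \<le> n"
      using not_less_Least[of m' "\<lambda>m. n < l_seq \<sigma> j m"] m' by (simp add: m_def[symmetric])
    with step[of m] m' have "l_seq \<sigma> j m \<le> n + B"
      by simp
    moreover have "\<sigma> (l_seq \<sigma> j m) = j"
      using enumerate_in_set[OF inf, of m'] by (simp add: m' l_seq_def fiber_def)
    ultimately show ?thesis
      using m by auto
  qed
  then show ?thesis by blast
qed

lemma pseudo_periodic_visits:
  assumes "pseudo_periodic \<sigma>"
  shows "\<exists>L. \<forall>n. \<forall>j\<in>Gamma_F \<sigma>. \<exists>k\<in>{n<..n + L}. \<sigma> k = j"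
proof -
  have "\<exists>B. \<forall>n. \<exists>k\<in>{n<..n + B}. \<sigma> k = j" if "j \<in> Gamma_F \<sigma>" for j
    using that assms by (intro bounded_gap_visits) (auto simp: Gamma_F_def pseudo_periodic_def)
  then obtain B where B: "\<And>j n. j \<in> Gamma_F \<sigma> \<Longrightarrow> \<exists>k\<in>{n<..n + B j}. \<sigma> k = j"
    by metis
  have "finite (Gamma_F \<sigma>)"
    using assms by (auto simp: pseudo_periodic_def)
  then have "B j \<le> Max (B ` Gamma_F \<sigma>)" if "j \<in> Gamma_F \<sigma>" for j
    using that by simp
  then have "\<exists>k\<in>{n<..n + Max (B ` Gamma_F \<sigma>)}. \<sigma> k = j" if "j \<in> Gamma_F \<sigma>" for j n
    using B[OF that, of n] that by (meson add_left_mono greaterThanAtMost_iff order_trans)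
  then show ?thesis by blast
qed

section \<open>Convergence of pseudo-periodic products\<close>

theorem theorem2p16:
  fixes sc :: "'k::real_or_complex \<Rightarrow> 'a::{real_inner, complete_space} \<Rightarrow> 'a"
    and ip :: "'a \<Rightarrow> 'a \<Rightarrow> 'k"
    and P :: "nat \<Rightarrow> 'a \<Rightarrow> 'a"
    and T :: "nat \<Rightarrow> 'a \<Rightarrow> 'a"
    and \<sigma> :: "nat \<Rightarrow> nat"
    and r :: nat
  assumes "hilbert_space sc ip"
    and "r \<ge> 1"
    and "\<And>i. i \<ge> 1 \<Longrightarrow> projection sc ip (P i)"
    and "inj_on P {1..r}"
    and "c_b sc ip r (\<lambda>i. range (P i)) < 1"
    and "\<And>i. i \<ge> r + 1 \<Longrightarrow> op_le ip (P (i + 1)) (P i)"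
    and "(\<Inter>i\<in>{1..r}. range (P i)) = (\<Inter>i\<in>{1..}. range (P i))"
    and "pseudo_periodic \<sigma>"
    and "Gamma_F \<sigma> = {1..r}"
    and "T 1 = P (\<sigma> 1)"
    and "\<And>n. n \<ge> 2 \<Longrightarrow> T n = P (\<sigma> n) \<circ> T (n - 1)"
  shows "\<forall>x. (\<lambda>n. T n x) \<longlonglongrightarrow> proj_onto sc ip (\<Inter>i\<in>{1..}. range (P i)) x"
proof
  fix x
  interpret hilbert_space sc ip by fact
  note P = assms(3)
  define M where "M = (\<Inter>i\<in>{1..}. range (P i))"
  define Q where "Q = proj_onto sc ip M"
  have "closed M"
    unfolding M_def by (intro closed_INT ballI closed_range_projection P) simp
  moreover have "subspace M"
    unfolding M_def by (intro subspace_Inter) (auto intro!: subspace_range_projection P)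
  ultimately have Q: "projection sc ip Q" and range_Q: "range Q = M"
    unfolding Q_def by (rule projection_onto_closed_subspace)+
  have fix_M: "P i m = m" if "m \<in> M" "i \<ge> 1" for i m
    using that projection_in_range_iff[OF P] by (auto simp: M_def)
  have \<sigma>1: "\<sigma> n \<ge> 1" if "n \<ge> 1" for n
    using assms(8) that by (auto simp: pseudo_periodic_def)

  \<comment> \<open>The kernel of \<open>Q\<close> is the orthogonal complement of \<open>M\<close>.\<close>
  define c where "c = c_b sc ip r (\<lambda>i. range (P i))"
  have c: "norm (left_prod P r y) \<le> c * norm y" if "Q y = 0" for y
  proof -
    have "left_prod (\<lambda>i. proj_onto sc ip (range (P i))) k = left_prod P k" for k
      by (induction k) (simp_all add: proj_onto_range P)
    then have c_eq: "c = onorm (left_prod P r \<circ> (\<lambda>x. x - Q x))"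
      unfolding c_def c_b_def assms(7) M_def[symmetric] range_Q[symmetric]
      by (simp add: proj_onto_orth_compl[OF Q])
    have "bounded_linear (left_prod P k)" for k
    proof (induction k)
      case (Suc k)
      then show ?case
        using bounded_linear_compose[OF projection_bounded_linear[OF P[of "Suc k"]]]
        by (simp add: o_def)
    qed (simp add: id_def bounded_linear_ident)
    then have "bounded_linear (left_prod P r \<circ> (\<lambda>x. x - Q x))"
      unfolding o_def
      by (rule bounded_linear_compose[OF _
            bounded_linear_sub[OF bounded_linear_ident projection_bounded_linear[OF Q]]])
    from onorm[OF this, of y] show ?thesis
      using that by (simp add: c_eq)
  qed

  \<comment> \<open>\<open>u\<close> is the orbit of the component of \<open>x\<close> orthogonal to \<open>M\<close>. It starts at \<open>T 1\<close>, so the next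
    projection applied to \<open>u n\<close> has index \<open>\<sigma> (n + 2)\<close>.\<close>
  define E where "E n = P (\<sigma> (n + 2))" for n
  define u where "u n = T (n + 1) (x - Q x)" for n
  have E: "projection sc ip (E n)" for n
    unfolding E_def by (intro P \<sigma>1) simp
  have u: "u (Suc n) = E n (u n)" for n
    using assms(11)[of "n + 2"] by (simp add: u_def E_def)
  have Q_P: "Q (P i y) = Q y" if "i \<ge> 1" for i y
  proof (rule ip_right_eqI)
    fix z
    have "P i (Q z) = Q z"
      using fix_M that range_Q by blast
    then show "ip (Q (P i y)) z = ip (Q y) z"
      by (simp add: projection_ip[OF Q] projection_ip[OF P[OF that]])
  qed
  interpret Q: bounded_linear Q
    by (rule projection_bounded_linear[OF Q])
  have Q_u: "Q (u n) = 0" for n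
  proof (induction n)
    case 0
    have "Q (P (\<sigma> 1) (x - Q x)) = Q (x - Q x)"
      by (intro Q_P \<sigma>1) simp
    then show ?case
      using assms(10) by (simp add: u_def Q.diff projection_idem[OF Q])
  next
    case (Suc n)
    have "Q (E n (u n)) = Q (u n)"
      unfolding E_def by (intro Q_P \<sigma>1) simp
    then show ?case
      by (simp add: u Suc)
  qed
  obtain L where L: "\<And>n j. j \<in> {1..r} \<Longrightarrow> \<exists>k\<in>{n<..n + L}. \<sigma> k = j"
    using pseudo_periodic_visits[OF assms(8)] assms(9) by metis
  have visits: "\<exists>k<L. E (n + k) = P j" if "j \<in> {1..r}" for n j
  proof -
    from L[OF that] obtain k where "k \<in> {n + 1<..n + 1 + L}" "\<sigma> k = j"
      by blast
    then have "n + 2 \<le> k"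
      by simp
    then obtain m where "k = n + 2 + m"
      using le_Suc_ex by blast
    with \<open>k \<in> _\<close> \<open>\<sigma> k = j\<close> have "m < L" "E (n + m) = P j"
      by (auto simp: E_def)
    then show ?thesis by blast
  qed
  have "u \<longlonglongrightarrow> 0"
  proof (rule orbit_tendsto_0[of E u r P L c])
    show "c < 1"
      using assms(5) by (simp add: c_def)
  qed (simp_all add: E u P visits c Q_u)
  moreover have "T (n + 1) x = Q x + u n" for n
  proof (induction n)
    case 0
    interpret bounded_linear "P (\<sigma> 1)"
      by (intro projection_bounded_linear P \<sigma>1) simp
    have "P (\<sigma> 1) (Q x) = Q x"
      by (intro fix_M \<sigma>1) (simp_all flip: range_Q)
    then show ?case
      using assms(10) by (simp add: u_def diff del: One_nat_def)
  next
    case (Suc n)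
    interpret bounded_linear "E n"
      by (rule projection_bounded_linear[OF E])
    have "T (Suc n + 1) x = E n (T (n + 1) x)"
      using assms(11)[of "n + 2"] by (simp add: E_def)
    also have "\<dots> = E n (Q x) + E n (u n)"
      unfolding Suc by (rule add)
    also have "E n (Q x) = Q x"
      unfolding E_def by (intro fix_M \<sigma>1) (simp_all flip: range_Q)
    finally show ?case
      by (simp only: u)
  qed
  ultimately have "(\<lambda>n. T (n + 1) x) \<longlonglongrightarrow> Q x + 0"
    by (simp only:) (intro tendsto_intros)
  then show "(\<lambda>n. T n x) \<longlonglongrightarrow> proj_onto sc ip (\<Inter>i\<in>{1..}. range (P i)) x"
    unfolding Q_def M_def by (simp add: LIMSEQ_imp_Suc)
qed

end
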